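(* Let $X$ be a Tychonoff space and let $I$ be an ideal in $C(X)$. Then $$\chi(C_{m^I}(X))=dn\Big(X\setminus\bigcap Z[I]\Big).$$
   Context: $C(X)$ is the ring of all real-valued continuous functions on $X$; ideals may be improper. $C_+(X)$ is the set of strictly positive $u\in C(X)$. $Z(g)=\{x\in X:g(x)=0\}$ and $\bigcap Z[I]=\bigcap_{g\in I}Z(g)$. The $m^I$-topology on $C(X)$ has as base the sets $B_m(f,I,u)=\{g\in C(X):|f(x)-g(x)|<u(x)\ \forall x\in X,\ f-g\in I\}$, $f\in C(X)$, $u\in C_+(X)$; $C_{m^I}(X)$ is $C(X)$ with this topology. For a space $Y$, the character is $\chi(Y)=\sup_{y\in Y}\chi(Y,y)$, where $\chi(Y,y)=\aleph_0+\min\{|\mathcal B_y|:\mathcal B_y\text{ is a base for }Y\text{ at }y\}$. A subset $F\subseteq C(X)$ is dominating on $A\subseteq X$ if for each $f\in C(X)$ there is $g\in F$ with $f(x)\le g(x)$ for all $x\in A$. The dominating number of $A$ is $dn(A)=\aleph_0+\min\{|F|:F\subseteq C(X)\text{ is dominating on }A\}$. *)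

theory Defs
  imports "HOL-Analysis.Analysis" "HOL-Algebra.Ideal"
begin

unbundle cardinal_syntax

section \<open>Minimum and supremum of cardinals\<close>

text \<open>
  Cardinals are represented, as in the library, by relations \<open>r\<close> with \<^term>\<open>Card_order r\<close>, and two
  of them are equal as cardinals iff they are related by \<open>=o\<close>.  Both definitions below are thus
  meant up to \<open>=o\<close>; the lemmas show that the choices exist.
\<close>

definition card_Min :: "'c rel set \<Rightarrow> 'c rel" where
  "card_Min R = (SOME r. r \<in> R \<and> (\<forall>r'\<in>R. r \<le>o r'))"

definition card_Sup :: "'c rel set \<Rightarrow> 'c rel" where
  "card_Sup R = card_Min {s. Card_order s \<and> (\<forall>r\<in>R. r \<le>o s)}"

lemma card_Min:
  assumes "R \<noteq> {}" "\<And>r. r \<in> R \<Longrightarrow> Card_order r"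
  shows "card_Min R \<in> R" "\<And>r. r \<in> R \<Longrightarrow> card_Min R \<le>o r"
proof -
  have "\<exists>r. r \<in> R \<and> (\<forall>r'\<in>R. r \<le>o r')"
    using exists_minim_Card_order[of R] assms by blast
  then have "card_Min R \<in> R \<and> (\<forall>r'\<in>R. card_Min R \<le>o r')"
    unfolding card_Min_def by (rule someI_ex)
  then show "card_Min R \<in> R" "\<And>r. r \<in> R \<Longrightarrow> card_Min R \<le>o r" by auto
qed

lemma card_Sup:
  fixes R :: "'c rel set"
  assumes "\<And>r. r \<in> R \<Longrightarrow> Card_order r"
  shows "Card_order (card_Sup R)"
    and "\<And>r. r \<in> R \<Longrightarrow> r \<le>o card_Sup R"
    and "\<And>s :: 'd rel. Card_order s \<Longrightarrow> (\<And>r. r \<in> R \<Longrightarrow> r \<le>o s) \<Longrightarrow> card_Sup R \<le>o s"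
proof -
  let ?U = "{s :: 'c rel. Card_order s \<and> (\<forall>r\<in>R. r \<le>o s)}"
  have top: "r \<le>o |UNIV :: 'c set|" if "Card_order r" for r :: "'c rel"
  proof -
    have "r =o |Field r|"
      using that card_of_Field_ordIso ordIso_symmetric by blast
    moreover have "|Field r| \<le>o |UNIV :: 'c set|" by (simp add: card_of_mono1)
    ultimately show ?thesis using ordIso_ordLeq_trans by blast
  qed
  then have "|UNIV :: 'c set| \<in> ?U" using assms by (auto simp: card_of_Card_order)
  then have ne: "?U \<noteq> {}" by blast
  have U: "card_Sup R \<in> ?U" "\<And>s. s \<in> ?U \<Longrightarrow> card_Sup R \<le>o s"
    unfolding card_Sup_def using card_Min[OF ne] by blast+
  then show co: "Card_order (card_Sup R)" and "\<And>r. r \<in> R \<Longrightarrow> r \<le>o card_Sup R" by auto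
  fix s :: "'d rel"
  assume s: "Card_order s" "\<And>r. r \<in> R \<Longrightarrow> r \<le>o s"
  show "card_Sup R \<le>o s"
  proof (cases "card_Sup R \<le>o s")
    case False
    have wo: "Well_order (card_Sup R)" "Well_order s"
      using co s(1) unfolding card_order_on_def by blast+
    then have "s \<le>o card_Sup R"
      using False ordLeq_total by blast
    then obtain B :: "'c set" where B: "|Field s| =o |B|"
      using internalize_card_of_ordLeq[of "Field s" "card_Sup R"] card_of_Field_ordIso[OF s(1)]
        ordIso_ordLeq_trans by blast
    have sB: "s =o |B|"
      using B card_of_Field_ordIso[OF s(1)] ordIso_symmetric ordIso_transitive by blast
    then have "|B| \<in> ?U"
      using s(2) ordLeq_ordIso_trans by (auto simp: card_of_Card_order)
    then have "card_Sup R \<le>o |B|" by (rule U(2))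
    then show ?thesis using sB ordIso_symmetric ordLeq_ordIso_trans by blast
  qed
qed

section \<open>Character of a space\<close>

definition local_base :: "'b topology \<Rightarrow> 'b \<Rightarrow> 'b set set \<Rightarrow> bool" where
  "local_base Y y \<B> \<longleftrightarrow>
     (\<forall>B\<in>\<B>. openin Y B \<and> y \<in> B) \<and>
     (\<forall>U. openin Y U \<and> y \<in> U \<longrightarrow> (\<exists>B\<in>\<B>. B \<subseteq> U))"

definition character_at :: "'b topology \<Rightarrow> 'b \<Rightarrow> (nat + 'b set) rel" where
  "character_at Y y = natLeq +c card_Min {|\<B>| | \<B>. local_base Y y \<B>}"

definition character :: "'b topology \<Rightarrow> (nat + 'b set) rel" where
  "character Y = card_Sup (character_at Y ` topspace Y)"

section \<open>The ring of continuous real-valued functions\<close>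

definition Tychonoff_space :: "'a topology \<Rightarrow> bool" where
  "Tychonoff_space X \<longleftrightarrow> t1_space X \<and> completely_regular_space X"

text \<open>
  A function on the carrier of \<open>X\<close> is represented by its extensional representative, so that
  equality in \<open>C(X)\<close> is equality on \<^term>\<open>topspace X\<close>.
\<close>

definition C_ring :: "'a topology \<Rightarrow> ('a \<Rightarrow> real) ring" where
  "C_ring X =
     \<lparr>carrier = {f. continuous_map X euclideanreal f \<and> f \<in> extensional (topspace X)},
      mult = (\<lambda>f g. \<lambda>x\<in>topspace X. f x * g x),
      one = (\<lambda>x\<in>topspace X. 1),
      zero = (\<lambda>x\<in>topspace X. 0),
      add = (\<lambda>f g. \<lambda>x\<in>topspace X. f x + g x)\<rparr>"

abbreviation C :: "'a topology \<Rightarrow> ('a \<Rightarrow> real) set" where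
  "C X \<equiv> carrier (C_ring X)"

definition C_pos :: "'a topology \<Rightarrow> ('a \<Rightarrow> real) set" where
  "C_pos X = {u \<in> C X. \<forall>x\<in>topspace X. 0 < u x}"

definition zero_set :: "'a topology \<Rightarrow> ('a \<Rightarrow> real) \<Rightarrow> 'a set" where
  "zero_set X g = {x \<in> topspace X. g x = 0}"

lemma mem_C: "f \<in> C X \<longleftrightarrow> continuous_map X euclideanreal f \<and> f \<in> extensional (topspace X)"
  by (simp add: C_ring_def)

lemma continuous_map_restrict_C:
  "continuous_map X euclideanreal f \<Longrightarrow> (\<lambda>x\<in>topspace X. f x) \<in> C X"
  using continuous_map_eq[of X euclideanreal f "\<lambda>x\<in>topspace X. f x"] by (simp add: mem_C)

lemma C_ring_cring: "cring (C_ring X)"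
proof (rule cringI)
  show "abelian_group (C_ring X)"
  proof (rule abelian_groupI)
    fix f g assume "f \<in> C X" "g \<in> C X"
    then show "f \<oplus>\<^bsub>C_ring X\<^esub> g \<in> C X"
      using continuous_map_restrict_C[of X "\<lambda>x. f x + g x"]
      by (simp add: C_ring_def continuous_map_add)
  next
    show "\<zero>\<^bsub>C_ring X\<^esub> \<in> C X"
      using continuous_map_restrict_C[of X "\<lambda>x. 0"] by (simp add: C_ring_def)
  next
    fix f assume f: "f \<in> C X"
    then show "\<zero>\<^bsub>C_ring X\<^esub> \<oplus>\<^bsub>C_ring X\<^esub> f = f"
      by (auto simp: C_ring_def extensional_def)
    have "(\<lambda>x\<in>topspace X. - f x) \<in> C X"
      using f continuous_map_restrict_C[of X "\<lambda>x. - f x"]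
      by (simp add: mem_C continuous_map_minus)
    then show "\<exists>g\<in>C X. g \<oplus>\<^bsub>C_ring X\<^esub> f = \<zero>\<^bsub>C_ring X\<^esub>"
      by (rule rev_bexI) (auto simp: C_ring_def)
  qed (auto simp: C_ring_def)
next
  show "Group.comm_monoid (C_ring X)"
  proof (rule comm_monoidI)
    fix f g assume "f \<in> C X" "g \<in> C X"
    then show "f \<otimes>\<^bsub>C_ring X\<^esub> g \<in> C X"
      using continuous_map_restrict_C[of X "\<lambda>x. f x * g x"]
      by (simp add: C_ring_def continuous_map_real_mult)
  next
    show "\<one>\<^bsub>C_ring X\<^esub> \<in> C X"
      using continuous_map_restrict_C[of X "\<lambda>x. 1"] by (simp add: C_ring_def)
  next
    fix f assume f: "f \<in> C X"
    then show "\<one>\<^bsub>C_ring X\<^esub> \<otimes>\<^bsub>C_ring X\<^esub> f = f"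
      by (auto simp: C_ring_def extensional_def)
  qed (auto simp: C_ring_def)
qed (auto simp: C_ring_def algebra_simps)

lemma C_ring_minus:
  assumes "f \<in> C X" "g \<in> C X"
  shows "f \<ominus>\<^bsub>C_ring X\<^esub> g = (\<lambda>x\<in>topspace X. f x - g x)"
proof -
  interpret cring "C_ring X" by (rule C_ring_cring)
  let ?n = "\<lambda>x\<in>topspace X. - g x"
  have n: "?n \<in> C X"
    using assms continuous_map_restrict_C[of X "\<lambda>x. - g x"]
    by (simp add: mem_C continuous_map_minus)
  have "?n \<oplus>\<^bsub>C_ring X\<^esub> g = \<zero>\<^bsub>C_ring X\<^esub>"
    by (auto simp: C_ring_def)
  then have "\<ominus>\<^bsub>C_ring X\<^esub> g = ?n"
    using n assms by (metis minus_equality)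
  then show ?thesis
    by (auto simp: a_minus_def C_ring_def)
qed

section \<open>The topology on the ring determined by an ideal\<close>

definition mI_basic :: "'a topology \<Rightarrow> ('a \<Rightarrow> real) set \<Rightarrow> ('a \<Rightarrow> real) \<Rightarrow> ('a \<Rightarrow> real) \<Rightarrow> ('a \<Rightarrow> real) set" where
  "mI_basic X I f u =
     {g \<in> C X. (\<forall>x\<in>topspace X. \<bar>f x - g x\<bar> < u x) \<and> f \<ominus>\<^bsub>C_ring X\<^esub> g \<in> I}"

definition mI_topology :: "'a topology \<Rightarrow> ('a \<Rightarrow> real) set \<Rightarrow> ('a \<Rightarrow> real) topology" where
  "mI_topology X I =
     topology (arbitrary union_of (\<lambda>B. \<exists>f\<in>C X. \<exists>u\<in>C_pos X. B = mI_basic X I f u))"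

lemma openin_mI_topology:
  assumes "ideal I (C_ring X)"
  shows "openin (mI_topology X I) =
    arbitrary union_of (\<lambda>B. \<exists>f\<in>C X. \<exists>u\<in>C_pos X. B = mI_basic X I f u)"
proof -
  interpret ideal I "C_ring X" by fact
  let ?P = "\<lambda>B. \<exists>f\<in>C X. \<exists>u\<in>C_pos X. B = mI_basic X I f u"
  have sub: "(\<lambda>x\<in>topspace X. a x + b x) \<in> I" if "a \<in> I" "b \<in> I" for a b
    using additive_subgroup.a_closed[OF is_additive_subgroup that] by (simp add: C_ring_def)
  have "(arbitrary union_of ?P) (S \<inter> T)" if ST: "?P S" "?P T" for S T
  proof -
    obtain f u where fu: "f \<in> C X" "u \<in> C_pos X" "S = mI_basic X I f u"
      using ST(1) by (elim bexE)
    obtain g v where gv: "g \<in> C X" "v \<in> C_pos X" "T = mI_basic X I g v"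
      using ST(2) by (elim bexE)
    have "\<exists>B. ?P B \<and> h \<in> B \<and> B \<subseteq> S \<inter> T" if h: "h \<in> S \<inter> T" for h
    proof -
      have hC: "h \<in> C X" using h fu by (auto simp: mI_basic_def)
      define w where "w = (\<lambda>x\<in>topspace X. min (u x - \<bar>f x - h x\<bar>) (v x - \<bar>g x - h x\<bar>))"
      have cont: "continuous_map X euclideanreal (\<lambda>x. min (u x - \<bar>f x - h x\<bar>) (v x - \<bar>g x - h x\<bar>))"
        using fu gv hC unfolding C_pos_def mem_C
        by (intro continuous_map_real_min continuous_map_diff continuous_map_real_abs) auto
      have w: "w \<in> C_pos X"
        using continuous_map_restrict_C[OF cont] h fu gv
        by (auto simp: C_pos_def w_def mI_basic_def)
      have "\<zero>\<^bsub>C_ring X\<^esub> \<in> I" by (rule additive_subgroup.zero_closed[OF is_additive_subgroup])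
      moreover have "h \<ominus>\<^bsub>C_ring X\<^esub> h = \<zero>\<^bsub>C_ring X\<^esub>"
        unfolding C_ring_minus[OF hC hC] by (simp add: C_ring_def)
      ultimately have hB: "h \<in> mI_basic X I h w"
        using w hC by (auto simp: mI_basic_def C_pos_def)
      have key: "mI_basic X I h w \<subseteq> mI_basic X I f' u'"
        if f': "f' \<in> C X" and hf: "h \<in> mI_basic X I f' u'"
          and le: "\<And>x. x \<in> topspace X \<Longrightarrow> w x \<le> u' x - \<bar>f' x - h x\<bar>" for f' u'
      proof
        fix k assume k: "k \<in> mI_basic X I h w"
        then have kC: "k \<in> C X" by (simp add: mI_basic_def)
        have "\<bar>f' x - k x\<bar> < u' x" if "x \<in> topspace X" for x
        proof -
          have "\<bar>h x - k x\<bar> < w x" using k that by (simp add: mI_basic_def)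
          with le[OF that] show ?thesis by linarith
        qed
        moreover have "f' \<ominus>\<^bsub>C_ring X\<^esub> k \<in> I"
        proof -
          have "f' \<ominus>\<^bsub>C_ring X\<^esub> h \<in> I" "h \<ominus>\<^bsub>C_ring X\<^esub> k \<in> I"
            using hf k by (auto simp: mI_basic_def)
          from sub[OF this] show ?thesis
            unfolding C_ring_minus[OF f' hC] C_ring_minus[OF hC kC] C_ring_minus[OF f' kC]
            by (simp cong: restrict_cong)
        qed
        ultimately show "k \<in> mI_basic X I f' u'" using kC by (simp add: mI_basic_def)
      qed
      have "mI_basic X I h w \<subseteq> S"
        unfolding fu(3) by (rule key) (use h fu in \<open>auto simp: w_def\<close>)
      moreover have "mI_basic X I h w \<subseteq> T"
        unfolding gv(3) by (rule key) (use h gv in \<open>auto simp: w_def\<close>)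
      ultimately have "mI_basic X I h w \<subseteq> S \<inter> T" by simp
      moreover have "?P (mI_basic X I h w)" using hC w by (intro bexI[of _ h] bexI[of _ w]) simp_all
      ultimately show ?thesis using hB by (intro exI[of _ "mI_basic X I h w"] conjI)
    qed
    then show ?thesis by (intro arbitrary_union_of_alt[THEN iffD2] ballI)
  qed
  then have "istopology (arbitrary union_of ?P)"
    by (intro istopology_base_eq[THEN iffD2] allI impI) (elim conjE)
  then show ?thesis
    unfolding mI_topology_def by (rule topology_inverse')
qed

lemma topspace_mI_topology:
  assumes "ideal I (C_ring X)"
  shows "topspace (mI_topology X I) = C X"
proof
  have "\<exists>\<U>. (\<forall>B\<in>\<U>. B \<subseteq> C X) \<and> \<Union>\<U> = topspace (mI_topology X I)"
    using openin_topspace[of "mI_topology X I"]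
    unfolding openin_mI_topology[OF assms] union_of_def
    by (auto simp: mI_basic_def)
  then show "topspace (mI_topology X I) \<subseteq> C X" by blast
  show "C X \<subseteq> topspace (mI_topology X I)"
  proof
    fix f assume f: "f \<in> C X"
    interpret ideal I "C_ring X" by fact
    have u: "(\<lambda>x\<in>topspace X. 1) \<in> C_pos X"
      using continuous_map_restrict_C[of X "\<lambda>x. 1"] by (simp add: C_pos_def)
    have "\<zero>\<^bsub>C_ring X\<^esub> \<in> I" by simp
    moreover have "f \<ominus>\<^bsub>C_ring X\<^esub> f = \<zero>\<^bsub>C_ring X\<^esub>"
      unfolding C_ring_minus[OF f f] by (simp add: C_ring_def)
    ultimately have "f \<in> mI_basic X I f (\<lambda>x\<in>topspace X. 1)"
      using f by (simp add: mI_basic_def)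
    moreover have "openin (mI_topology X I) (mI_basic X I f (\<lambda>x\<in>topspace X. 1))"
      unfolding openin_mI_topology[OF assms] using f u by (intro union_of_inc) (auto simp: arbitrary_def)
    ultimately show "f \<in> topspace (mI_topology X I)"
      using openin_subset by blast
  qed
qed

section \<open>Dominating number\<close>

definition dominating_on :: "'a topology \<Rightarrow> 'a set \<Rightarrow> ('a \<Rightarrow> real) set \<Rightarrow> bool" where
  "dominating_on X A F \<longleftrightarrow> F \<subseteq> C X \<and> (\<forall>f\<in>C X. \<exists>g\<in>F. \<forall>x\<in>A. f x \<le> g x)"

definition dominating_number :: "'a topology \<Rightarrow> 'a set \<Rightarrow> (nat + ('a \<Rightarrow> real)) rel" where
  "dominating_number X A = natLeq +c card_Min {|F| | F. dominating_on X A F}"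

end

(* Neighbourhoods of f are governed by positive functions u, and passing to 1/u turns refinement of
   neighbourhoods into domination: since members of I vanish off A = X - (INT g:I. Z(g)), only
   the values of u on A matter; conversely, at x in A with g(x) nonzero for some g in I, the ideal
   contains functions below u in absolute value whose value at x is u(x)/2, so the neighbourhood
   of 0 determines u on A up to the factor 2. *)

theory Submission
  imports Defs
begin

section \<open>Reciprocals in C(X) and closure properties of the ideal\<close>

lemma C_zero: "(\<lambda>x\<in>topspace X. 0) \<in> C X"
  using continuous_map_restrict_C[of X "\<lambda>x. 0"] by simp

lemma C_pos_inverse:
  assumes "u \<in> C_pos X"
  shows "(\<lambda>x\<in>topspace X. c / u x) \<in> C X"
proof -
  have "continuous_map X euclideanreal (\<lambda>x. c / u x)"
    using assms by (intro continuous_map_real_divide) (fastforce simp: C_pos_def mem_C)+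
  then show ?thesis by (rule continuous_map_restrict_C)
qed

text \<open>A dominating function may vanish or be negative somewhere. Truncating it at 1 from below
  makes the reciprocal positive and continuous, and only enlarges the function.\<close>

lemma C_pos_inverse_max:
  assumes "f \<in> C X"
  shows "(\<lambda>x\<in>topspace X. 1 / max (f x) 1) \<in> C_pos X"
proof -
  have "continuous_map X euclideanreal (\<lambda>x. 1 / max (f x) 1)"
    using assms by (intro continuous_map_real_divide continuous_map_real_max) (auto simp: mem_C)
  then show ?thesis using continuous_map_restrict_C by (fastforce simp: C_pos_def)
qed

lemma ideal_C_add:
  assumes "ideal I (C_ring X)" "a \<in> I" "b \<in> I"
  shows "(\<lambda>x\<in>topspace X. a x + b x) \<in> I"
  using additive_subgroup.a_closed[OF ideal.axioms(1)[OF assms(1)] assms(2,3)]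
  by (simp add: C_ring_def)

lemma ideal_C_mult:
  assumes "ideal I (C_ring X)" "a \<in> I" "c \<in> C X"
  shows "(\<lambda>x\<in>topspace X. c x * a x) \<in> I"
  using ideal.I_l_closed[OF assms] by (simp add: C_ring_def)

lemma ideal_C_zero:
  assumes "ideal I (C_ring X)"
  shows "(\<lambda>x\<in>topspace X. 0) \<in> I"
  using additive_subgroup.zero_closed[OF ideal.axioms(1)[OF assms]] by (simp add: C_ring_def)

lemma ideal_C_subset:
  assumes "ideal I (C_ring X)"
  shows "I \<subseteq> C X"
  using additive_subgroup.a_subset[OF ideal.axioms(1)[OF assms]] .

section \<open>Basic neighbourhoods in the topology\<close>

lemma mem_mI_basic:
  assumes "f \<in> C X"
  shows "g \<in> mI_basic X I f u \<longleftrightarrow>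
    g \<in> C X \<and> (\<forall>x\<in>topspace X. \<bar>f x - g x\<bar> < u x) \<and> (\<lambda>x\<in>topspace X. f x - g x) \<in> I"
  using C_ring_minus[OF assms] by (auto simp: mI_basic_def)

lemma mI_basic_centre:
  assumes "ideal I (C_ring X)" "f \<in> C X" "u \<in> C_pos X"
  shows "f \<in> mI_basic X I f u"
  using assms ideal_C_zero[OF assms(1)] by (simp add: mem_mI_basic C_pos_def)

lemma openin_mI_basic:
  assumes "ideal I (C_ring X)" "f \<in> C X" "u \<in> C_pos X"
  shows "openin (mI_topology X I) (mI_basic X I f u)"
  unfolding openin_mI_topology[OF assms(1)]
  using assms(2,3) by (intro union_of_inc) (auto simp: arbitrary_def)

text \<open>A base set containing \<open>f\<close> may be centred at another \<open>g\<close>. It is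
  recentred at \<open>f\<close> by taking the remaining margin \<open>v - |g - f|\<close> as radius;
  the triangle inequality gives the bound, and additivity of \<open>I\<close> gives
  \<open>g - k\<close> in \<open>I\<close>.\<close>

lemma openin_mI_topology_contains_basic:
  assumes I: "ideal I (C_ring X)" and U: "openin (mI_topology X I) U" and f: "f \<in> U"
  obtains u where "u \<in> C_pos X" "mI_basic X I f u \<subseteq> U"
proof -
  have "\<exists>B. (\<exists>g\<in>C X. \<exists>v\<in>C_pos X. B = mI_basic X I g v) \<and> f \<in> B \<and> B \<subseteq> U"
    using U f unfolding openin_mI_topology[OF I] arbitrary_union_of_alt by blast
  then obtain g v where g: "g \<in> C X" and v: "v \<in> C_pos X"
    and fB: "f \<in> mI_basic X I g v" and sub: "mI_basic X I g v \<subseteq> U" by blast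
  have fC: "f \<in> C X" using fB by (simp add: mI_basic_def)
  define u where "u = (\<lambda>x\<in>topspace X. v x - \<bar>g x - f x\<bar>)"
  have "continuous_map X euclideanreal (\<lambda>x. v x - \<bar>g x - f x\<bar>)"
    using v g fC unfolding C_pos_def mem_C
    by (intro continuous_map_diff continuous_map_real_abs) auto
  then have "u \<in> C_pos X"
    using continuous_map_restrict_C fB by (fastforce simp: C_pos_def u_def mI_basic_def)
  moreover have "mI_basic X I f u \<subseteq> mI_basic X I g v"
  proof
    fix k assume k: "k \<in> mI_basic X I f u"
    have "\<bar>g x - k x\<bar> < v x" if "x \<in> topspace X" for x
    proof -
      have "\<bar>f x - k x\<bar> < v x - \<bar>g x - f x\<bar>"
        using k that by (simp add: mI_basic_def u_def)
      then show ?thesis by linarith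
    qed
    moreover have "(\<lambda>x\<in>topspace X. g x - k x) \<in> I"
    proof -
      have "(\<lambda>x\<in>topspace X. g x - f x) \<in> I" "(\<lambda>x\<in>topspace X. f x - k x) \<in> I"
        using fB k mem_mI_basic[OF g] mem_mI_basic[OF fC] by blast+
      from ideal_C_add[OF I this] show ?thesis by (simp cong: restrict_cong)
    qed
    ultimately show "k \<in> mI_basic X I g v"
      using k by (simp add: mem_mI_basic[OF g] mem_mI_basic[OF fC])
  qed
  ultimately show thesis using that sub by blast
qed

section \<open>Radii compared off the common zeros of the ideal\<close>

lemma mI_basic_mono_on_cozero:
  assumes f: "f \<in> C X" and u: "u \<in> C_pos X"
    and le: "\<And>x. x \<in> topspace X - (\<Inter>g\<in>I. zero_set X g) \<Longrightarrow> v x \<le> u x"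
  shows "mI_basic X I f v \<subseteq> mI_basic X I f u"
proof
  fix h assume h: "h \<in> mI_basic X I f v"
  have "\<bar>f x - h x\<bar> < u x" if x: "x \<in> topspace X" for x
  proof (cases "x \<in> (\<Inter>g\<in>I. zero_set X g)")
    case True
    \<comment> \<open>The difference \<open>f - h\<close> lies in \<open>I\<close>, so it vanishes
      at every common zero; there any positive radius will do.\<close>
    then have "f x - h x = 0"
      using h x by (force simp: mem_mI_basic[OF f] zero_set_def)
    then show ?thesis using u x by (simp add: C_pos_def)
  next
    case False
    then have "v x \<le> u x" using le x by blast
    moreover have "\<bar>f x - h x\<bar> < v x" using h x by (simp add: mem_mI_basic[OF f])
    ultimately show ?thesis by linarith
  qed
  then show "h \<in> mI_basic X I f u" using h by (simp add: mem_mI_basic[OF f])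
qed

lemma mI_basic_zero_subsetD:
  assumes I: "ideal I (C_ring X)" and u: "u \<in> C_pos X"
    and sub: "mI_basic X I (\<lambda>x\<in>topspace X. 0) u \<subseteq> mI_basic X I (\<lambda>x\<in>topspace X. 0) v"
    and x: "x \<in> topspace X - (\<Inter>g\<in>I. zero_set X g)"
  shows "u x / 2 < v x"
proof -
  obtain g where g: "g \<in> I" "g x \<noteq> 0" using x by (auto simp: zero_set_def)
  have gC: "g \<in> C X" using ideal_C_subset[OF I] g by blast
  have pos: "(g x)\<^sup>2 + (g y)\<^sup>2 > 0" for y using g(2) by (simp add: add_pos_nonneg)
  \<comment> \<open>The multiple \<open>h = q * g\<close> of \<open>g\<close> equals
    \<open>u\<close> times \<open>g^2 / (g(x)^2 + g^2)\<close>. With \<open>x\<close> fixed the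
    denominator is at least \<open>g(x)^2 > 0\<close>, which gives continuity; the fraction is below
    1 everywhere and equals 1/2 at \<open>x\<close>.\<close>
  define q where "q = (\<lambda>y. u y * (g y / ((g x)\<^sup>2 + (g y)\<^sup>2)))"
  define h where "h = (\<lambda>y\<in>topspace X. q y * g y)"
  have "continuous_map X euclideanreal q"
    unfolding q_def using u gC pos
    by (intro continuous_map_real_mult continuous_map_real_divide continuous_map_add
        continuous_map_real_pow) (auto simp: C_pos_def mem_C less_imp_neq[symmetric])
  then have q: "(\<lambda>y\<in>topspace X. q y) \<in> C X" and nq: "(\<lambda>y\<in>topspace X. - q y) \<in> C X"
    by (auto intro!: continuous_map_restrict_C continuous_map_minus)
  have hI: "h \<in> I"
    using ideal_C_mult[OF I g(1) q] by (simp add: h_def cong: restrict_cong)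
  \<comment> \<open>Membership in a neighbourhood of 0 is tested on \<open>0 - h\<close>, hence the
    sign.\<close>
  have "(\<lambda>y\<in>topspace X. - h y) \<in> I"
    using ideal_C_mult[OF I g(1) nq] by (simp add: h_def cong: restrict_cong)
  moreover have "\<bar>h y\<bar> < u y" if "y \<in> topspace X" for y
  proof -
    have "u y > 0" using u that by (simp add: C_pos_def)
    moreover have "(g y)\<^sup>2 / ((g x)\<^sup>2 + (g y)\<^sup>2) < 1"
      using pos[of y] g(2) by simp
    ultimately have "u y * ((g y)\<^sup>2 / ((g x)\<^sup>2 + (g y)\<^sup>2)) < u y"
      by (simp only: mult_less_cancel_left2) simp
    moreover have "h y = u y * ((g y)\<^sup>2 / ((g x)\<^sup>2 + (g y)\<^sup>2))"
      using that by (simp add: h_def q_def power2_eq_square)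
    moreover have "0 \<le> u y * ((g y)\<^sup>2 / ((g x)\<^sup>2 + (g y)\<^sup>2))"
      using \<open>u y > 0\<close> by simp
    ultimately show ?thesis by simp
  qed
  ultimately have "h \<in> mI_basic X I (\<lambda>x\<in>topspace X. 0) u"
    using ideal_C_subset[OF I] hI by (auto simp: mem_mI_basic[OF C_zero] cong: restrict_cong)
  then have "\<bar>h x\<bar> < v x"
    using sub x by (force simp: mem_mI_basic[OF C_zero])
  moreover have "h x = u x / 2"
    using x g(2) by (simp add: h_def q_def power2_eq_square)
  ultimately show ?thesis by simp
qed

section \<open>Passage between dominating families and local bases\<close>

lemma local_base_of_dominating_on:
  assumes I: "ideal I (C_ring X)" and f: "f \<in> C X"
    and F: "dominating_on X (topspace X - (\<Inter>g\<in>I. zero_set X g)) F"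
  shows "local_base (mI_topology X I) f
    ((\<lambda>g. mI_basic X I f (\<lambda>x\<in>topspace X. 1 / max (g x) 1)) ` F)"
proof -
  have FC: "F \<subseteq> C X" using F by (simp add: dominating_on_def)
  have "\<exists>g\<in>F. mI_basic X I f (\<lambda>x\<in>topspace X. 1 / max (g x) 1) \<subseteq> U"
    if U: "openin (mI_topology X I) U" "f \<in> U" for U
  proof -
    obtain u where u: "u \<in> C_pos X" and sub: "mI_basic X I f u \<subseteq> U"
      using openin_mI_topology_contains_basic[OF I U] .
    \<comment> \<open>Domination is applied to \<open>1 / u\<close>: where
      \<open>1 / u \<le> g\<close>, also \<open>1 / max g 1 \<le> u\<close>, so the neighbourhood
      given by \<open>g\<close> lies in the one given by \<open>u\<close>.\<close>
    obtain g where g: "g \<in> F"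
      and le: "\<And>x. x \<in> topspace X - (\<Inter>g\<in>I. zero_set X g) \<Longrightarrow> (\<lambda>x\<in>topspace X. 1 / u x) x \<le> g x"
      using F C_pos_inverse[OF u, of 1] unfolding dominating_on_def by metis
    have "mI_basic X I f (\<lambda>x\<in>topspace X. 1 / max (g x) 1) \<subseteq> mI_basic X I f u"
    proof (rule mI_basic_mono_on_cozero[OF f u])
      fix x assume x: "x \<in> topspace X - (\<Inter>g\<in>I. zero_set X g)"
      have "u x > 0" using u x by (simp add: C_pos_def)
      moreover have "1 / u x \<le> max (g x) 1" using le[OF x] x by simp
      ultimately have "1 / max (g x) 1 \<le> u x"
        by (simp add: divide_le_eq mult.commute)
      then show "(\<lambda>x\<in>topspace X. 1 / max (g x) 1) x \<le> u x" using x by simp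
    qed
    then show ?thesis using g sub by blast
  qed
  moreover have "(\<lambda>x\<in>topspace X. 1 / max (g x) 1) \<in> C_pos X" if "g \<in> F" for g
    using FC that C_pos_inverse_max by blast
  ultimately show ?thesis
    using mI_basic_centre[OF I f] openin_mI_basic[OF I f] by (simp add: local_base_def)
qed

text \<open>Each member of the local base contains a neighbourhood of 0 of some radius
  \<open>u\<close>, and contributes the single function \<open>2 / u\<close>; this bounds the size
  of the family.\<close>

lemma dominating_on_of_local_base:
  assumes I: "ideal I (C_ring X)"
    and B: "local_base (mI_topology X I) (\<lambda>x\<in>topspace X. 0) \<B>"
  obtains F where "dominating_on X (topspace X - (\<Inter>g\<in>I. zero_set X g)) F" "|F| \<le>o |\<B>|"
proof -
  let ?N = "mI_basic X I (\<lambda>x\<in>topspace X. 0)"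
  have "\<exists>u\<in>C_pos X. ?N u \<subseteq> B" if "B \<in> \<B>" for B
    using openin_mI_topology_contains_basic[OF I] B that unfolding local_base_def by metis
  then obtain u where u: "\<And>B. B \<in> \<B> \<Longrightarrow> u B \<in> C_pos X" "\<And>B. B \<in> \<B> \<Longrightarrow> ?N (u B) \<subseteq> B"
    by metis
  let ?F = "(\<lambda>B. \<lambda>x\<in>topspace X. 2 / u B x) ` \<B>"
  have "\<exists>g\<in>?F. \<forall>x\<in>topspace X - (\<Inter>g\<in>I. zero_set X g). f x \<le> g x" if f: "f \<in> C X" for f
  proof -
    \<comment> \<open>The function to be dominated is turned into a radius. A base member inside
      that neighbourhood gives \<open>u / 2 < 1 / max f 1\<close> off the common zeros, which
      inverts to \<open>f < 2 / u\<close>; the 2 pays for the factor lost in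
      \<open>mI_basic_zero_subsetD\<close>.\<close>
    let ?v = "\<lambda>x\<in>topspace X. 1 / max (f x) 1"
    have v: "?v \<in> C_pos X" by (rule C_pos_inverse_max[OF f])
    obtain W where W: "W \<in> \<B>" "W \<subseteq> ?N ?v"
      using B openin_mI_basic[OF I C_zero v] mI_basic_centre[OF I C_zero v]
      unfolding local_base_def by blast
    then have sub: "?N (u W) \<subseteq> ?N ?v" using u(2) by blast
    have "f x \<le> 2 / u W x" if x: "x \<in> topspace X - (\<Inter>g\<in>I. zero_set X g)" for x
    proof -
      have "u W x / 2 < 1 / max (f x) 1"
        using mI_basic_zero_subsetD[OF I u(1)[OF W(1)] sub x] x by simp
      moreover have "u W x > 0" using u(1)[OF W(1)] x by (simp add: C_pos_def)
      moreover have "max (f x) 1 > 0" by simp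
      ultimately have "max (f x) 1 < 2 / u W x"
        by (simp only: divide_less_eq less_divide_eq) (simp add: mult.commute)
      then show ?thesis by simp
    qed
    then show ?thesis using W(1) by (intro bexI[of _ "\<lambda>x\<in>topspace X. 2 / u W x"]) auto
  qed
  moreover have "?F \<subseteq> C X" using C_pos_inverse u(1) by blast
  ultimately have "dominating_on X (topspace X - (\<Inter>g\<in>I. zero_set X g)) ?F"
    by (simp only: dominating_on_def) blast
  then show thesis using that card_of_image by blast
qed

section \<open>Attained minima and comparison of cardinals\<close>

lemma Card_order_character_at: "Card_order (character_at Y y)"
  unfolding character_at_def by (rule Card_order_csum)

text \<open>The open neighbourhoods of \<open>y\<close> form a local base, so the minimum ranges
  over a nonempty set and is attained.\<close>

lemma card_Min_local_base:
  assumes "y \<in> topspace Y"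
  obtains \<B> where "local_base Y y \<B>" "card_Min {|\<B>| | \<B>. local_base Y y \<B>} = |\<B>|"
proof -
  have "local_base Y y {U. openin Y U \<and> y \<in> U}" by (auto simp: local_base_def)
  then have "{|\<B>| | \<B>. local_base Y y \<B>} \<noteq> {}" by blast
  then have "card_Min {|\<B>| | \<B>. local_base Y y \<B>} \<in> {|\<B>| | \<B>. local_base Y y \<B>}"
    by (rule card_Min) (auto simp: card_of_Card_order)
  then show thesis using that by blast
qed

text \<open>The bound \<open>r\<close> may live on another type, so that sets of neighbourhoods can
  be compared with sets of functions.\<close>

lemma character_at_le:
  assumes "local_base Y y \<B>" "|\<B>| \<le>o r"
  shows "character_at Y y \<le>o natLeq +c r"
proof -
  have "card_Min {|\<B>| | \<B>. local_base Y y \<B>} \<le>o |\<B>|"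
    by (rule card_Min) (use assms(1) in \<open>auto simp: card_of_Card_order\<close>)
  then show ?thesis
    unfolding character_at_def using assms(2) by (blast intro: csum_mono2 ordLeq_transitive)
qed

text \<open>\<open>C X\<close> dominates itself, so the minimum is attained.\<close>

lemma card_Min_dominating_on:
  obtains F where "dominating_on X A F" "card_Min {|F| | F. dominating_on X A F} = |F|"
proof -
  have "dominating_on X A (C X)" by (auto simp: dominating_on_def)
  then have "{|F| | F. dominating_on X A F} \<noteq> {}" by blast
  then have "card_Min {|F| | F. dominating_on X A F} \<in> {|F| | F. dominating_on X A F}"
    by (rule card_Min) (auto simp: card_of_Card_order)
  then show thesis using that by blast
qed

lemma dominating_number_le:
  assumes "dominating_on X A F" "|F| \<le>o r"
  shows "dominating_number X A \<le>o natLeq +c r"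
proof -
  have "card_Min {|F| | F. dominating_on X A F} \<le>o |F|"
    by (rule card_Min) (use assms(1) in \<open>auto simp: card_of_Card_order\<close>)
  then show ?thesis
    unfolding dominating_number_def using assms(2) by (blast intro: csum_mono2 ordLeq_transitive)
qed

theorem theorem5p4:
  fixes X :: "'a topology" and I :: "('a \<Rightarrow> real) set"
  assumes "Tychonoff_space X"
    and "ideal I (C_ring X)"
  shows "character (mI_topology X I) =o
    dominating_number X (topspace X - (\<Inter>g\<in>I. zero_set X g))"
proof -
  let ?Y = "mI_topology X I" and ?A = "topspace X - (\<Inter>g\<in>I. zero_set X g)"
  let ?o = "\<lambda>x\<in>topspace X. 0"
  note I = assms(2)
  have co: "Card_order r" if "r \<in> character_at ?Y ` topspace ?Y" for r
    using that by (auto simp: Card_order_character_at)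
  have "character ?Y \<le>o dominating_number X ?A"
    unfolding character_def
  proof (rule card_Sup(3)[OF co])
    show "Card_order (dominating_number X ?A)"
      unfolding dominating_number_def by (rule Card_order_csum)
    fix r assume "r \<in> character_at ?Y ` topspace ?Y"
    then obtain f where f: "f \<in> C X" and r: "r = character_at ?Y f"
      using topspace_mI_topology[OF I] by auto
    \<comment> \<open>Being dominating on \<open>?A\<close> does not involve \<open>f\<close>, so a
      smallest such family bounds the character at every point alike.\<close>
    obtain F where F: "dominating_on X ?A F" "card_Min {|F| | F. dominating_on X ?A F} = |F|"
      by (rule card_Min_dominating_on)
    show "r \<le>o dominating_number X ?A"
      unfolding r dominating_number_def F(2)
      by (rule character_at_le[OF local_base_of_dominating_on[OF I f F(1)] card_of_image])
  qed
  moreover have "dominating_number X ?A \<le>o character ?Y"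
  proof -
    \<comment> \<open>For this direction one point suffices: the character is a supremum, hence at
      least its value at 0.\<close>
    have o: "?o \<in> topspace ?Y" using C_zero topspace_mI_topology[OF I] by blast
    obtain \<B> where B: "local_base ?Y ?o \<B>" "card_Min {|\<B>| | \<B>. local_base ?Y ?o \<B>} = |\<B>|"
      using card_Min_local_base[OF o] .
    obtain F where F: "dominating_on X ?A F" "|F| \<le>o |\<B>|"
      using dominating_on_of_local_base[OF I B(1)] .
    have "dominating_number X ?A \<le>o character_at ?Y ?o"
      unfolding character_at_def B(2) by (rule dominating_number_le[OF F])
    moreover have "character_at ?Y ?o \<le>o character ?Y"
      unfolding character_def by (rule card_Sup(2)[OF co]) (use o in blast)+
    ultimately show ?thesis by (rule ordLeq_transitive)
  qed
  ultimately show ?thesis by (simp add: ordIso_iff_ordLeq)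
qed

end
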